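(* Let $a,b,c$ be nonzero real constants and set $$H_1=u_{ty}-a u_{xy}-b u_{yy}+u_{xxxy}+c\,(u_{yyyy}-6v u_{yy})-3(u_y u_{xx}+u_x u_{xy}),\qquad H_2=u_{yy}-v_x .$$ Let $F_1=F_1(y,t)$, $F_2=F_2(t)$, $F_3=F_3(t)$ be arbitrary smooth functions, and let $$\Lambda_1=F_1,\qquad \Lambda_2=6cvF_1+yF_2+F_3+\int(bF_{1y}-cF_{1yyy}-F_{1t})\,dy .$$ Define $$T_t=\tfrac12u_yF_1-\tfrac12uF_{1y},$$ $$\begin{aligned}T_x=\;&\tfrac34uu_xF_{1y}+\tfrac34uu_{xy}F_1+\tfrac12auF_{1y}-\tfrac94u_yu_xF_1-\tfrac12au_yF_1-\tfrac14u_{xx}F_{1y}+\tfrac34u_{xxy}F_1\\&-3cv^2F_1-vyF_2-vF_3-bv\int F_{1y}\,dy+cv\int F_{1yyy}\,dy+v\int F_{1t}\,dy,\end{aligned}$$ $$\begin{aligned}T_y=\;&yu_yF_2-uF_2-bu_yF_1+cu_yF_{1yy}+u_yF_3-cu_{yy}F_{1y}+cu_{yyy}F_1+\tfrac12uF_{1t}-\tfrac34u_x^2F_1-\tfrac12au_xF_1\\&-\tfrac34uu_{xx}F_1+\tfrac14u_{xxx}F_1+\tfrac12u_tF_1+bu_y\int F_{1y}\,dy-cu_y\int F_{1yyy}\,dy-u_y\int F_{1t}\,dy.\end{aligned}$$ Then, for all smooth functions $u(x,y,t)$, $v(x,y,t)$, $$D_tT_t+D_xT_x+D_yT_y=\Lambda_1H_1+\Lambda_2H_2,$$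 and hence $D_tT_t+D_xT_x+D_yT_y=0$ for all solutions of the system $H_1=0$, $H_2=0$; i.e. $(T_t,T_x,T_y)$ is a conserved vector of this system with multipliers $\Lambda_1,\Lambda_2$.
   Context: $D_t,D_x,D_y$ are the total derivative operators. The subscripts $t,x,y$ on $T$ merely label components of the conserved vector (they are not derivatives), while subscripts on $u,v,F_1$ denote partial derivatives, e.g. $F_{1y}=\partial F_1/\partial y$. The symbols $\int F_{1y}\,dy$, $\int F_{1yyy}\,dy$, $\int F_{1t}\,dy$ denote fixed smooth antiderivatives in $y$ (functions of $(y,t)$), with the same choices used in $\Lambda_2$, $T_x$ and $T_y$, and $\int(bF_{1y}-cF_{1yyy}-F_{1t})\,dy$ is $b\int F_{1y}dy-c\int F_{1yyy}dy-\int F_{1t}dy$. The system $H_1=0,\ H_2=0$ is the $(2+1)$-dimensional extended Boiti-Leon-Manna-Pempinelli system. *)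

theory Defs
  imports "HOL-Analysis.Analysis"
begin

primrec Ck_on :: "nat \<Rightarrow> 'a::real_normed_vector set \<Rightarrow> ('a \<Rightarrow> real) \<Rightarrow> bool" where
  "Ck_on 0 S f \<longleftrightarrow> continuous_on S f"
| "Ck_on (Suc k) S f \<longleftrightarrow>
     (\<forall>p\<in>S. f differentiable (at p)) \<and> (\<forall>h. Ck_on k S (\<lambda>p. frechet_derivative f (at p) h))"

text \<open>Meant for open \<open>S\<close> in a finite-dimensional space.\<close>

definition smooth_on :: "'a::real_normed_vector set \<Rightarrow> ('a \<Rightarrow> real) \<Rightarrow> bool" where
  "smooth_on S f \<longleftrightarrow> (\<forall>k. Ck_on k S f)"

text \<open>Points are triples \<open>(x, y, t)\<close>, so \<open>snd (x, y, t) = (y, t)\<close>.\<close>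

type_synonym point = "real \<times> real \<times> real"
type_synonym field = "point \<Rightarrow> real"

definition dx :: "field \<Rightarrow> field" where
  "dx f = (\<lambda>(x, y, t). deriv (\<lambda>s. f (s, y, t)) x)"

definition dy :: "field \<Rightarrow> field" where
  "dy f = (\<lambda>(x, y, t). deriv (\<lambda>s. f (x, s, t)) y)"

definition dt :: "field \<Rightarrow> field" where
  "dt f = (\<lambda>(x, y, t). deriv (\<lambda>s. f (x, y, s)) t)"

text \<open>Partial derivatives of functions of \<open>(y, t)\<close>.\<close>

definition py :: "(real \<times> real \<Rightarrow> real) \<Rightarrow> real \<times> real \<Rightarrow> real" where
  "py F = (\<lambda>(y, t). deriv (\<lambda>s. F (s, t)) y)"

definition pt :: "(real \<times> real \<Rightarrow> real) \<Rightarrow> real \<times> real \<Rightarrow> real" where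
  "pt F = (\<lambda>(y, t). deriv (\<lambda>s. F (y, s)) t)"

definition antideriv_y :: "(real \<times> real) set \<Rightarrow> (real \<times> real \<Rightarrow> real) \<Rightarrow> (real \<times> real \<Rightarrow> real) \<Rightarrow> bool" where
  "antideriv_y W f G \<longleftrightarrow> smooth_on W G \<and> (\<forall>q\<in>W. py G q = f q)"

text \<open>A differential function is represented by its evaluation along fields \<open>u\<close>, \<open>v\<close>; the total
  derivatives differentiate the resulting function of \<open>(x, y, t)\<close>, i.e. they also act through
  \<open>u\<close>, \<open>v\<close> and their derivatives.\<close>

type_synonym diff_fun = "field \<Rightarrow> field \<Rightarrow> field"

definition D_x :: "diff_fun \<Rightarrow> diff_fun" where
  "D_x P u v = dx (P u v)"

definition D_y :: "diff_fun \<Rightarrow> diff_fun" where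
  "D_y P u v = dy (P u v)"

definition D_t :: "diff_fun \<Rightarrow> diff_fun" where
  "D_t P u v = dt (P u v)"

definition total_div :: "diff_fun \<Rightarrow> diff_fun \<Rightarrow> diff_fun \<Rightarrow> diff_fun" where
  "total_div Pt Px Py u v p = D_t Pt u v p + D_x Px u v p + D_y Py u v p"

definition solution_on :: "point set \<Rightarrow> diff_fun \<Rightarrow> diff_fun \<Rightarrow> field \<Rightarrow> field \<Rightarrow> bool" where
  "solution_on \<Omega> E1 E2 u v \<longleftrightarrow>
     smooth_on \<Omega> u \<and> smooth_on \<Omega> v \<and> (\<forall>p\<in>\<Omega>. E1 u v p = 0 \<and> E2 u v p = 0)"

definition conserved_vector ::
    "point set \<Rightarrow> diff_fun \<Rightarrow> diff_fun \<Rightarrow> diff_fun \<Rightarrow> diff_fun \<Rightarrow> diff_fun \<Rightarrow> bool" where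
  "conserved_vector \<Omega> E1 E2 Pt Px Py \<longleftrightarrow>
     (\<forall>u v. solution_on \<Omega> E1 E2 u v \<longrightarrow> (\<forall>p\<in>\<Omega>. total_div Pt Px Py u v p = 0))"

text \<open>Subscripts are applied from left to right: \<open>u_ty\<close> is \<open>dy (dt u)\<close>.\<close>

definition H1 :: "real \<Rightarrow> real \<Rightarrow> real \<Rightarrow> diff_fun" where
  "H1 a b c u v p =
     dy (dt u) p - a * dy (dx u) p - b * dy (dy u) p + dy (dx (dx (dx u))) p
     + c * (dy (dy (dy (dy u))) p - 6 * v p * dy (dy u) p)
     - 3 * (dy u p * dx (dx u) p + dx u p * dy (dx u) p)"

definition H2 :: diff_fun where
  "H2 u v p = dy (dy u) p - dx v p"

text \<open>The parameters \<open>I1\<close>, \<open>I3\<close>, \<open>It\<close> below stand for the chosen antiderivatives in \<open>y\<close> of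
  \<open>F1_y\<close>, \<open>F1_yyy\<close> and \<open>F1_t\<close>, respectively.\<close>

definition Lambda1 :: "(real \<times> real \<Rightarrow> real) \<Rightarrow> diff_fun" where
  "Lambda1 F1 u v p = (case p of (x, y, t) \<Rightarrow> F1 (y, t))"

definition Lambda2 :: "real \<Rightarrow> real \<Rightarrow> (real \<times> real \<Rightarrow> real) \<Rightarrow> (real \<Rightarrow> real) \<Rightarrow> (real \<Rightarrow> real) \<Rightarrow>
    (real \<times> real \<Rightarrow> real) \<Rightarrow> (real \<times> real \<Rightarrow> real) \<Rightarrow> (real \<times> real \<Rightarrow> real) \<Rightarrow> diff_fun" where
  "Lambda2 b c F1 F2 F3 I1 I3 It u v p = (case p of (x, y, t) \<Rightarrow>
     6 * c * v p * F1 (y, t) + y * F2 t + F3 t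
     + (b * I1 (y, t) - c * I3 (y, t) - It (y, t)))"

definition T_t :: "(real \<times> real \<Rightarrow> real) \<Rightarrow> diff_fun" where
  "T_t F1 u v p = (case p of (x, y, t) \<Rightarrow>
     1/2 * dy u p * F1 (y, t) - 1/2 * u p * py F1 (y, t))"

definition T_x :: "real \<Rightarrow> real \<Rightarrow> real \<Rightarrow> (real \<times> real \<Rightarrow> real) \<Rightarrow> (real \<Rightarrow> real) \<Rightarrow> (real \<Rightarrow> real) \<Rightarrow>
    (real \<times> real \<Rightarrow> real) \<Rightarrow> (real \<times> real \<Rightarrow> real) \<Rightarrow> (real \<times> real \<Rightarrow> real) \<Rightarrow> diff_fun" where
  "T_x a b c F1 F2 F3 I1 I3 It u v p = (case p of (x, y, t) \<Rightarrow>
     3/4 * u p * dx u p * py F1 (y, t) + 3/4 * u p * dy (dx u) p * F1 (y, t)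
     + 1/2 * a * u p * py F1 (y, t) - 9/4 * dy u p * dx u p * F1 (y, t)
     - 1/2 * a * dy u p * F1 (y, t) - 1/4 * dx (dx u) p * py F1 (y, t)
     + 3/4 * dy (dx (dx u)) p * F1 (y, t) - 3 * c * (v p)^2 * F1 (y, t)
     - v p * y * F2 t - v p * F3 t
     - b * v p * I1 (y, t) + c * v p * I3 (y, t) + v p * It (y, t))"

definition T_y :: "real \<Rightarrow> real \<Rightarrow> real \<Rightarrow> (real \<times> real \<Rightarrow> real) \<Rightarrow> (real \<Rightarrow> real) \<Rightarrow> (real \<Rightarrow> real) \<Rightarrow>
    (real \<times> real \<Rightarrow> real) \<Rightarrow> (real \<times> real \<Rightarrow> real) \<Rightarrow> (real \<times> real \<Rightarrow> real) \<Rightarrow> diff_fun" where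
  "T_y a b c F1 F2 F3 I1 I3 It u v p = (case p of (x, y, t) \<Rightarrow>
     y * dy u p * F2 t - u p * F2 t - b * dy u p * F1 (y, t) + c * dy u p * py (py F1) (y, t)
     + dy u p * F3 t - c * dy (dy u) p * py F1 (y, t) + c * dy (dy (dy u)) p * F1 (y, t)
     + 1/2 * u p * pt F1 (y, t) - 3/4 * (dx u p)^2 * F1 (y, t) - 1/2 * a * dx u p * F1 (y, t)
     - 3/4 * u p * dx (dx u) p * F1 (y, t) + 1/4 * dx (dx (dx u)) p * F1 (y, t)
     + 1/2 * dt u p * F1 (y, t)
     + b * dy u p * I1 (y, t) - c * dy u p * I3 (y, t) - dy u p * It (y, t))"

end

theory Submission
  imports Defs
begin

text \<open>Everything except the symmetry of second derivatives is the product rule followed by ring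
  arithmetic. The antiderivatives do not depend on \<open>x\<close>, so only their \<open>y\<close>-derivatives enter, and
  these are prescribed. The symmetry is the classical argument: the second difference of \<open>f\<close> over a
  small parallelogram is, by two applications of the mean value theorem, a value of either mixed
  derivative nearby.\<close>

section \<open>Directional derivatives\<close>

text \<open>The chain rule, stated for a general curve so that it serves both the segments
  \<open>p + s *\<^sub>R h + t *\<^sub>R k\<close> of the mean value argument and the coordinate
  lines that define \<open>dx\<close>, \<open>dy\<close>, \<open>dt\<close>, \<open>py\<close> and
  \<open>pt\<close>.\<close>

lemma has_real_derivative_along_curve:
  fixes f :: "'a::real_normed_vector \<Rightarrow> real"
  assumes "f differentiable at (g x)" and "(g has_vector_derivative h) (at x)"
  shows "((\<lambda>s. f (g s)) has_real_derivative frechet_derivative f (at (g x)) h) (at x)"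
proof -
  have f: "(f has_derivative frechet_derivative f (at (g x))) (at (g x))"
    using assms(1) by (simp add: frechet_derivative_works)
  then interpret bounded_linear "frechet_derivative f (at (g x))"
    by (rule has_derivative_bounded_linear)
  have "((\<lambda>s. f (g s)) has_derivative (\<lambda>s. frechet_derivative f (at (g x)) (s *\<^sub>R h))) (at x)"
    using has_derivative_compose[OF assms(2)[unfolded has_vector_derivative_def] f] .
  then show ?thesis
    by (simp add: has_field_derivative_def scaleR mult_commute_abs)
qed

text \<open>The second difference is the increment over [0, r] of the function sending s to f(p + s
  h + r k) - f(p + s h). The mean value theorem in s turns it into r times a difference of
  \<open>Df h\<close> along k, and the mean value theorem in t evaluates that difference.\<close>

lemma second_difference_eq_frechet_derivative:
  fixes f :: "'a::real_normed_vector \<Rightarrow> real"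
  defines "Df \<equiv> \<lambda>h q. frechet_derivative f (at q) h"
  assumes "r > 0"
    and S: "\<And>s t. s \<in> {0..r} \<Longrightarrow> t \<in> {0..r} \<Longrightarrow> p + s *\<^sub>R h + t *\<^sub>R k \<in> S"
    and f: "\<And>q. q \<in> S \<Longrightarrow> f differentiable at q"
    and Df: "\<And>q. q \<in> S \<Longrightarrow> Df h differentiable at q"
  shows "\<exists>s\<in>{0..r}. \<exists>t\<in>{0..r}.
    f (p + r *\<^sub>R h + r *\<^sub>R k) - f (p + r *\<^sub>R h) - f (p + r *\<^sub>R k) + f p
      = r\<^sup>2 * frechet_derivative (Df h) (at (p + s *\<^sub>R h + t *\<^sub>R k)) k"
proof -
  have "((\<lambda>s. f (p + s *\<^sub>R h + t *\<^sub>R k)) has_real_derivative Df h (p + s *\<^sub>R h + t *\<^sub>R k)) (at s)"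
    if "s \<in> {0..r}" "t \<in> {0..r}" for s t
    unfolding Df_def
    using that
    by (intro has_real_derivative_along_curve f S)
       (auto intro!: derivative_eq_intros simp: has_vector_derivative_def)
  \<comment> \<open>Only the two sides t = r and t = 0 of the parallelogram enter: their difference
    is the function to which the first mean value theorem applies.\<close>
  from this[where t = r] this[where t = 0]
  have "((\<lambda>s. f (p + s *\<^sub>R h + r *\<^sub>R k) - f (p + s *\<^sub>R h)) has_real_derivative
      Df h (p + s *\<^sub>R h + r *\<^sub>R k) - Df h (p + s *\<^sub>R h)) (at s)" if "0 \<le> s" "s \<le> r" for s
    using that \<open>r > 0\<close> by (intro DERIV_diff) auto
  from MVT2[OF \<open>r > 0\<close> this] obtain s where s: "0 < s" "s < r"
    and eq_s: "f (p + r *\<^sub>R h + r *\<^sub>R k) - f (p + r *\<^sub>R h) - (f (p + r *\<^sub>R k) - f p)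
      = r * (Df h (p + s *\<^sub>R h + r *\<^sub>R k) - Df h (p + s *\<^sub>R h))"
    by auto
  have "((\<lambda>t. Df h (p + s *\<^sub>R h + t *\<^sub>R k)) has_real_derivative
      frechet_derivative (Df h) (at (p + s *\<^sub>R h + t *\<^sub>R k)) k) (at t)"
    if "0 \<le> t" "t \<le> r" for t
    using that s
    by (intro has_real_derivative_along_curve Df S)
       (auto intro!: derivative_eq_intros simp: has_vector_derivative_def)
  from MVT2[OF \<open>r > 0\<close> this] obtain t where t: "0 < t" "t < r"
    and eq_t: "Df h (p + s *\<^sub>R h + r *\<^sub>R k) - Df h (p + s *\<^sub>R h)
      = r * frechet_derivative (Df h) (at (p + s *\<^sub>R h + t *\<^sub>R k)) k"
    by auto
  show ?thesis
    using s t eq_s unfolding eq_t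
    by (intro bexI[of _ s] bexI[of _ t]) (auto simp: power2_eq_square)
qed

text \<open>The second difference is symmetric in \<open>h\<close> and \<open>k\<close>, so both
  mixed derivatives attain one common value at points arbitrarily close to \<open>p\<close>;
  continuity then forces them to agree at \<open>p\<close>.\<close>

lemma mixed_frechet_derivative_commute:
  fixes f :: "'a::real_normed_vector \<Rightarrow> real"
  defines "Df \<equiv> \<lambda>h q. frechet_derivative f (at q) h"
  assumes "open S" "p \<in> S"
    and f: "\<And>q. q \<in> S \<Longrightarrow> f differentiable at q"
    and Df: "\<And>q h. q \<in> S \<Longrightarrow> Df h differentiable at q"
    and cont: "\<And>h k. continuous_on S (\<lambda>q. frechet_derivative (Df h) (at q) k)"
  shows "frechet_derivative (Df h) (at p) k = frechet_derivative (Df k) (at p) h"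
proof -
  define A where "A = (\<lambda>h k q. frechet_derivative (Df h) (at q) k)"
  have close: "\<bar>A h k p - A k h p\<bar> \<le> e" if "e > 0" for e
  proof -
    \<comment> \<open>The filter is not punctured at \<open>p\<close>, because the points supplied
      by the mean value theorem may coincide with \<open>p\<close>, for instance when
      \<open>h\<close> and \<open>k\<close> vanish.\<close>
    have "(A h k \<longlongrightarrow> A h k p) (nhds p)" for h k
    proof -
      have "isCont (A h k) p"
        using cont \<open>open S\<close> \<open>p \<in> S\<close> by (simp add: A_def continuous_on_eq_continuous_at)
      then show ?thesis
        by (simp add: isCont_def tendsto_at_iff_tendsto_nhds)
    qed
    then have "\<forall>\<^sub>F q in nhds p. dist (A h k q) (A h k p) < e/2 \<and> dist (A k h q) (A k h p) < e/2 \<and> q \<in> S"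
      using \<open>e > 0\<close> eventually_nhds_in_open[OF \<open>open S\<close> \<open>p \<in> S\<close>]
      by (intro eventually_conj tendstoD) auto
    then obtain d where "d > 0" and d: "\<And>q. dist q p < d \<Longrightarrow>
        dist (A h k q) (A h k p) < e/2 \<and> dist (A k h q) (A k h p) < e/2 \<and> q \<in> S"
      by (auto simp: eventually_nhds_metric)
    \<comment> \<open>This scale keeps the whole parallelogram in the ball of radius
      \<open>d\<close> around \<open>p\<close>, hence in \<open>S\<close>. The summand 1 makes the
      denominator positive even for h = k = 0 and the distance bound strict.\<close>
    define r where "r = d / (norm h + norm k + 1)"
    have den: "norm h + norm k + 1 > 0"
      by (smt (verit) norm_ge_zero)
    then have "r > 0"
      using \<open>d > 0\<close> by (simp add: r_def)
    have box: "dist (p + s *\<^sub>R h + t *\<^sub>R k) p < d" if "s \<in> {0..r}" "t \<in> {0..r}" for s t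
    proof -
      have "dist (p + s *\<^sub>R h + t *\<^sub>R k) p \<le> s * norm h + t * norm k"
        using that norm_triangle_ineq[of "s *\<^sub>R h" "t *\<^sub>R k"] by (simp add: dist_norm add.assoc)
      also have "\<dots> \<le> r * norm h + r * norm k"
        using that by (intro add_mono mult_right_mono) auto
      also have "\<dots> < r * (norm h + norm k + 1)"
        using \<open>r > 0\<close> by (simp add: distrib_left)
      also have "\<dots> = d"
        using den by (simp add: r_def)
      finally show ?thesis .
    qed
    obtain s t where st: "s \<in> {0..r}" "t \<in> {0..r}"
      and 1: "f (p + r *\<^sub>R h + r *\<^sub>R k) - f (p + r *\<^sub>R h) - f (p + r *\<^sub>R k) + f p
        = r\<^sup>2 * A h k (p + s *\<^sub>R h + t *\<^sub>R k)"
      using second_difference_eq_frechet_derivative[OF \<open>r > 0\<close>, of p h k S f] box d f Df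
      unfolding A_def Df_def by blast
    have box': "dist (p + t *\<^sub>R k + s *\<^sub>R h) p < d" if "s \<in> {0..r}" "t \<in> {0..r}" for s t
      using box[OF that] by (simp add: ac_simps)
    obtain s' t' where st': "s' \<in> {0..r}" "t' \<in> {0..r}"
      and 2: "f (p + r *\<^sub>R k + r *\<^sub>R h) - f (p + r *\<^sub>R k) - f (p + r *\<^sub>R h) + f p
        = r\<^sup>2 * A k h (p + t' *\<^sub>R k + s' *\<^sub>R h)"
      using second_difference_eq_frechet_derivative[OF \<open>r > 0\<close>, of p k h S f] box' d f Df
      unfolding A_def Df_def by blast
    have "r\<^sup>2 * A h k (p + s *\<^sub>R h + t *\<^sub>R k) = r\<^sup>2 * A k h (p + t' *\<^sub>R k + s' *\<^sub>R h)"
      unfolding 1[symmetric] 2[symmetric] by (simp add: ac_simps)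
    then have "A h k (p + s *\<^sub>R h + t *\<^sub>R k) = A k h (p + t' *\<^sub>R k + s' *\<^sub>R h)"
      using \<open>r > 0\<close> by simp
    then show ?thesis
      using d[OF box[OF st]] d[OF box'[OF st']] unfolding dist_real_def by linarith
  qed
  have "\<bar>A h k p - A k h p\<bar> \<le> 0"
    by (rule field_le_epsilon) (simp add: close)
  then show ?thesis
    by (simp add: A_def)
qed

section \<open>Smooth functions on open sets\<close>

text \<open>On an open set the derivative at a point sees only the values of the function in
  \<open>S\<close>. Both functions are generalised in the induction because the successor step
  compares their directional derivatives. This transfers smoothness to the partial derivatives,
  which are known to be directional derivatives only on the domain.\<close>

lemma Ck_on_cong:
  assumes "open S" "\<And>q. q \<in> S \<Longrightarrow> f q = g q" "Ck_on k S f"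
  shows "Ck_on k S g"
  using assms(2,3)
proof (induction k arbitrary: f g)
  case 0
  then show ?case
    using continuous_on_cong[of S S f g] by simp
next
  case (Suc k)
  have deriv: "(g has_derivative frechet_derivative f (at q)) (at q)" if "q \<in> S" for q
  proof (rule has_derivative_transform_within_open[OF _ \<open>open S\<close> that])
    show "(f has_derivative frechet_derivative f (at q)) (at q)"
      using Suc.prems(2) that by (simp add: frechet_derivative_works[symmetric])
  qed (use Suc.prems(1) in auto)
  have "Ck_on k S (\<lambda>q. frechet_derivative g (at q) h)" for h
  proof (rule Suc.IH)
    show "frechet_derivative f (at q) h = frechet_derivative g (at q) h" if "q \<in> S" for q
      using frechet_derivative_at[OF deriv[OF that]] by simp
    show "Ck_on k S (\<lambda>q. frechet_derivative f (at q) h)"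
      using Suc.prems(2) by simp
  qed
  then show ?case
    using deriv by (auto simp: differentiable_def)
qed

lemma smooth_on_cong:
  "open S \<Longrightarrow> (\<And>q. q \<in> S \<Longrightarrow> f q = g q) \<Longrightarrow> smooth_on S f \<Longrightarrow> smooth_on S g"
  unfolding smooth_on_def using Ck_on_cong by blast

lemma smooth_on_continuous_on: "smooth_on S f \<Longrightarrow> continuous_on S f"
  unfolding smooth_on_def by (metis Ck_on.simps(1))

lemma smooth_on_differentiable: "smooth_on S f \<Longrightarrow> q \<in> S \<Longrightarrow> f differentiable at q"
  unfolding smooth_on_def by (metis Ck_on.simps(2))

lemma smooth_on_frechet_derivative:
  "smooth_on S f \<Longrightarrow> smooth_on S (\<lambda>q. frechet_derivative f (at q) h)"
  unfolding smooth_on_def by (metis Ck_on.simps(2))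

text \<open>The first derivatives enter as \<open>g\<close> and \<open>g'\<close>, prescribed on
  \<open>S\<close> only, so that partial derivatives can be inserted for them; openness of
  \<open>S\<close> makes this local agreement enough for differentiating again.\<close>

lemma smooth_on_mixed_derivative_commute:
  assumes "open S" "smooth_on S f" "p \<in> S"
    and g: "\<And>q. q \<in> S \<Longrightarrow> g q = frechet_derivative f (at q) h"
    and g': "\<And>q. q \<in> S \<Longrightarrow> g' q = frechet_derivative f (at q) k"
  shows "frechet_derivative g (at p) k = frechet_derivative g' (at p) h"
proof -
  have congr: "frechet_derivative g (at p) = frechet_derivative (\<lambda>q. frechet_derivative f (at q) h) (at p)"
    if "\<And>q. q \<in> S \<Longrightarrow> g q = frechet_derivative f (at q) h" for g h
    using assms(1-3) that
    by (intro frechet_derivative_transform_within_open[symmetric, where X = S]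
          smooth_on_differentiable smooth_on_frechet_derivative) auto
  have "frechet_derivative (\<lambda>q. frechet_derivative f (at q) h) (at p) k
      = frechet_derivative (\<lambda>q. frechet_derivative f (at q) k) (at p) h"
  proof (rule mixed_frechet_derivative_commute[OF assms(1,3)])
  qed (use assms(2) in \<open>auto intro: smooth_on_differentiable smooth_on_continuous_on
      smooth_on_frechet_derivative\<close>)
  then show ?thesis
    by (simp only: congr[of g h, OF g] congr[of g' k, OF g'])
qed

section \<open>Partial derivatives\<close>

lemma has_vector_derivative_coordinate_line:
  "((\<lambda>s. (s, y, t)) has_vector_derivative (1, 0, 0)) (at (x::real))"
  "((\<lambda>s. (x', s, t)) has_vector_derivative (0, 1, 0)) (at (y'::real))"
  "((\<lambda>s. (x', y, s)) has_vector_derivative (0, 0, 1)) (at (t'::real))"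
  "((\<lambda>s. (s, t)) has_vector_derivative (1, 0)) (at (y'::real))"
  "((\<lambda>s. (y, s)) has_vector_derivative (0, 1)) (at (t'::real))"
  for x' y t :: real
  by (auto intro!: derivative_eq_intros simp: has_vector_derivative_def zero_prod_def)

text \<open>The bridge between partial derivatives, defined by \<open>deriv\<close> along coordinate
  lines, and smoothness, defined by Frechet derivatives.\<close>

lemma partial_eq_frechet_derivative:
  "f differentiable at p \<Longrightarrow> dx f p = frechet_derivative f (at p) (1, 0, 0)"
  "f differentiable at p \<Longrightarrow> dy f p = frechet_derivative f (at p) (0, 1, 0)"
  "f differentiable at p \<Longrightarrow> dt f p = frechet_derivative f (at p) (0, 0, 1)"
  "F differentiable at q \<Longrightarrow> py F q = frechet_derivative F (at q) (1, 0)"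
  "F differentiable at q \<Longrightarrow> pt F q = frechet_derivative F (at q) (0, 1)"
  by (auto simp: dx_def dy_def dt_def py_def pt_def split: prod.splits intro!: DERIV_imp_deriv
      has_real_derivative_along_curve has_vector_derivative_coordinate_line)

lemma has_real_derivative_partial:
  "f differentiable at (x, y, t) \<Longrightarrow> ((\<lambda>s. f (s, y, t)) has_real_derivative dx f (x, y, t)) (at x)"
  "f differentiable at (x, y, t) \<Longrightarrow> ((\<lambda>s. f (x, s, t)) has_real_derivative dy f (x, y, t)) (at y)"
  "f differentiable at (x, y, t) \<Longrightarrow> ((\<lambda>s. f (x, y, s)) has_real_derivative dt f (x, y, t)) (at t)"
  "F differentiable at (y, t) \<Longrightarrow> ((\<lambda>s. F (s, t)) has_real_derivative py F (y, t)) (at y)"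
  "F differentiable at (y, t) \<Longrightarrow> ((\<lambda>s. F (y, s)) has_real_derivative pt F (y, t)) (at t)"
  by (auto simp: partial_eq_frechet_derivative
      intro!: has_real_derivative_along_curve has_vector_derivative_coordinate_line)

lemma smooth_on_partial:
  "open \<Omega> \<Longrightarrow> smooth_on \<Omega> f \<Longrightarrow> smooth_on \<Omega> (dx f)"
  "open \<Omega> \<Longrightarrow> smooth_on \<Omega> f \<Longrightarrow> smooth_on \<Omega> (dy f)"
  "open \<Omega> \<Longrightarrow> smooth_on \<Omega> f \<Longrightarrow> smooth_on \<Omega> (dt f)"
  "open W \<Longrightarrow> smooth_on W F \<Longrightarrow> smooth_on W (py F)"
  "open W \<Longrightarrow> smooth_on W F \<Longrightarrow> smooth_on W (pt F)"
  by (rule smooth_on_cong[OF _ _ smooth_on_frechet_derivative],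
      auto simp: partial_eq_frechet_derivative smooth_on_differentiable)+

text \<open>Both equations move the y-derivative outermost, which is the order used in
  \<open>H1\<close> and in the components of the conserved vector.\<close>

lemma partial_commute:
  assumes "open \<Omega>" "smooth_on \<Omega> f" "p \<in> \<Omega>"
  shows "dx (dy f) p = dy (dx f) p" and "dt (dy f) p = dy (dt f) p"
  using assms
  by (auto simp: partial_eq_frechet_derivative smooth_on_differentiable[where S = \<Omega>] smooth_on_partial
      intro!: smooth_on_mixed_derivative_commute[where S = \<Omega>])

lemma pt_py_commute:
  assumes "open W" "smooth_on W F" "q \<in> W"
  shows "pt (py F) q = py (pt F) q"
  using assms
  by (auto simp: partial_eq_frechet_derivative smooth_on_differentiable[where S = W] smooth_on_partial
      intro!: smooth_on_mixed_derivative_commute[where S = W])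

section \<open>The conservation law\<close>

text \<open>Each of the three total derivatives is expanded by the product rule, with the
  derivatives of \<open>u\<close>, \<open>v\<close> and \<open>F1\<close> as atoms; after the mixed
  derivatives are brought to one order, the claim is a polynomial identity.\<close>

lemma total_div_BLMP:
  assumes \<Omega>: "open \<Omega>" and F: "smooth_on (snd ` \<Omega>) F1"
    and I1: "antideriv_y (snd ` \<Omega>) (py F1) I1"
    and I3: "antideriv_y (snd ` \<Omega>) (py (py (py F1))) I3"
    and It: "antideriv_y (snd ` \<Omega>) (pt F1) It"
    and u: "smooth_on \<Omega> u" and v: "smooth_on \<Omega> v" and p: "p \<in> \<Omega>"
  shows "total_div (T_t F1) (T_x a b c F1 F2 F3 I1 I3 It) (T_y a b c F1 F2 F3 I1 I3 It) u v p
    = Lambda1 F1 u v p * H1 a b c u v p + Lambda2 b c F1 F2 F3 I1 I3 It u v p * H2 u v p"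
proof -
  obtain x y t where xyt: "p = (x, y, t)"
    by (cases p) auto
  define W where "W = snd ` \<Omega>"
  have W: "open W"
    unfolding W_def using \<Omega> by (rule open_image_snd)
  have q: "(y, t) \<in> W"
    using p by (force simp: W_def xyt)
  note F = F[folded W_def]
  note p = p[unfolded xyt]
  have I: "smooth_on W I1" "smooth_on W I3" "smooth_on W It"
    "py I1 (y, t) = py F1 (y, t)" "py I3 (y, t) = py (py (py F1)) (y, t)" "py It (y, t) = pt F1 (y, t)"
    using I1 I3 It q by (auto simp: antideriv_y_def W_def)
  \<comment> \<open>Every derivative occurring in the components is recorded as smooth, so that it
    can be differentiated once more.\<close>
  note x_smooth = smooth_on_partial(1)[OF \<Omega>] and y_smooth = smooth_on_partial(2)[OF \<Omega>]
    and t_smooth = smooth_on_partial(3)[OF \<Omega>]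
  note ux = x_smooth[OF u] and uy = y_smooth[OF u] and ut = t_smooth[OF u]
  note uxx = x_smooth[OF ux] and uxy = y_smooth[OF ux] and uyy = y_smooth[OF uy]
  note uxxx = x_smooth[OF uxx] and uxxy = y_smooth[OF uxx] and uyyy = y_smooth[OF uyy]
  note Fy = smooth_on_partial(4)[OF W F] and Ft = smooth_on_partial(5)[OF W F]
  note Fyy = smooth_on_partial(4)[OF W Fy]
  note deriv = has_real_derivative_partial(1-3)[OF smooth_on_differentiable[OF _ p]]
    has_real_derivative_partial(4-5)[OF smooth_on_differentiable[OF _ q]]
  have Dt: "D_t (T_t F1) u v p =
      1/2 * (dt (dy u) p * F1 (y, t) + dy u p * pt F1 (y, t))
      - 1/2 * (dt u p * py F1 (y, t) + u p * pt (py F1) (y, t))"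
    \<comment> \<open>The definition of \<open>dt\<close> is instantiated so that only the outer
      total derivative becomes a \<open>deriv\<close>; the partial derivatives of \<open>u\<close>
      inside stay atomic. The same device is used for \<open>dx\<close> and \<open>dy\<close>
      below.\<close>
    unfolding D_t_def dt_def[of "T_t F1 u v"] xyt prod.case T_t_def
    by (rule DERIV_imp_deriv,
        (rule deriv(3)[OF u] deriv(3)[OF uy] deriv(5)[OF F] deriv(5)[OF Fy]
          derivative_eq_intros refl)+)
       (simp add: algebra_simps)
  have Dx: "D_x (T_x a b c F1 F2 F3 I1 I3 It) u v p =
      3/4 * ((dx u p)\<^sup>2 + u p * dx (dx u) p) * py F1 (y, t)
      + 3/4 * (dx u p * dy (dx u) p + u p * dx (dy (dx u)) p) * F1 (y, t)
      + 1/2 * a * dx u p * py F1 (y, t)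
      - 9/4 * (dx (dy u) p * dx u p + dy u p * dx (dx u) p) * F1 (y, t)
      - 1/2 * a * dx (dy u) p * F1 (y, t) - 1/4 * dx (dx (dx u)) p * py F1 (y, t)
      + 3/4 * dx (dy (dx (dx u))) p * F1 (y, t) - 6 * c * v p * dx v p * F1 (y, t)
      - dx v p * (y * F2 t + F3 t + b * I1 (y, t) - c * I3 (y, t) - It (y, t))"
    unfolding D_x_def dx_def[of "T_x a b c F1 F2 F3 I1 I3 It u v"] xyt prod.case T_x_def
    by (rule DERIV_imp_deriv,
        (rule deriv(1)[OF u] deriv(1)[OF v] deriv(1)[OF ux] deriv(1)[OF uy] deriv(1)[OF uxx]
        deriv(1)[OF uxy] deriv(1)[OF uxxy] derivative_eq_intros refl)+)
       (simp add: algebra_simps power2_eq_square)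
  \<comment> \<open>Two cancellations are already carried out here: y u_y F2 - u F2 contributes only
    y u_yy F2, and the three terms c (u_y F1_yy - u_yy F1_y + u_yyy F1) contribute only c (u_y
    F1_yyy + u_yyyy F1).\<close>
  have Dy: "D_y (T_y a b c F1 F2 F3 I1 I3 It) u v p =
      dy (dy u) p * (y * F2 t + F3 t + b * I1 (y, t) - c * I3 (y, t) - It (y, t))
      + dy u p * (b * py I1 (y, t) - c * py I3 (y, t) - py It (y, t))
      - b * (dy (dy u) p * F1 (y, t) + dy u p * py F1 (y, t))
      + c * (dy u p * py (py (py F1)) (y, t) + dy (dy (dy (dy u))) p * F1 (y, t))
      + 1/2 * (dy u p * pt F1 (y, t) + u p * py (pt F1) (y, t))
      - 3/2 * dx u p * dy (dx u) p * F1 (y, t) - 3/4 * (dx u p)\<^sup>2 * py F1 (y, t)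
      - 1/2 * a * (dy (dx u) p * F1 (y, t) + dx u p * py F1 (y, t))
      - 3/4 * (dy u p * dx (dx u) p * F1 (y, t) + u p * dy (dx (dx u)) p * F1 (y, t)
          + u p * dx (dx u) p * py F1 (y, t))
      + 1/4 * (dy (dx (dx (dx u))) p * F1 (y, t) + dx (dx (dx u)) p * py F1 (y, t))
      + 1/2 * (dy (dt u) p * F1 (y, t) + dt u p * py F1 (y, t))"
    unfolding D_y_def dy_def[of "T_y a b c F1 F2 F3 I1 I3 It u v"] xyt prod.case T_y_def
    by (rule DERIV_imp_deriv,
        (rule deriv(2)[OF u] deriv(2)[OF ux] deriv(2)[OF uy] deriv(2)[OF ut] deriv(2)[OF uxx]
        deriv(2)[OF uyy] deriv(2)[OF uxxx] deriv(2)[OF uyyy] deriv(4)[OF F] deriv(4)[OF Fy]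
        deriv(4)[OF Fyy] deriv(4)[OF Ft] deriv(4)[OF I(1)] deriv(4)[OF I(2)] deriv(4)[OF I(3)]
        derivative_eq_intros refl)+)
       (simp add: algebra_simps power2_eq_square)
  \<comment> \<open>One swap of the two outermost derivatives suffices each time, since the
    components carry at most one y-derivative, placed outermost, in the terms on which x or t
    acts.\<close>
  have mixed: "dx (dy u) p = dy (dx u) p" "dx (dy (dx u)) p = dy (dx (dx u)) p"
    "dx (dy (dx (dx u))) p = dy (dx (dx (dx u))) p" "dt (dy u) p = dy (dt u) p"
    "pt (py F1) (y, t) = py (pt F1) (y, t)"
    using \<Omega> u ux uxx p W F q by (simp_all add: partial_commute pt_py_commute xyt)
  have L: "Lambda1 F1 u v p = F1 (y, t)" "Lambda2 b c F1 F2 F3 I1 I3 It u v p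
      = 6 * c * v p * F1 (y, t) + y * F2 t + F3 t + (b * I1 (y, t) - c * I3 (y, t) - It (y, t))"
    by (simp_all add: Lambda1_def Lambda2_def xyt)
  show ?thesis
    \<comment> \<open>The prescribed y-derivatives of \<open>I1\<close>, \<open>I3\<close> and
      \<open>It\<close> cancel the u_y terms in F1_y, F1_yyy and F1_t, the last of which comes half
      from \<open>Dt\<close> and half from \<open>Dy\<close>. The part 6 c v F1 of
      \<open>Lambda2\<close> times u_yy cancels the term -6 c v u_yy of \<open>H1\<close> times F1,
      and the two terms in u F1_ty cancel by symmetry.\<close>
    unfolding total_div_def Dt Dx Dy mixed I(4-6) L H1_def H2_def
    by (simp add: algebra_simps power2_eq_square)
qed

theorem mainTheorem4:
  fixes a b c :: real
    and \<Omega> :: "(real \<times> real \<times> real) set"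
    and F1 I1 I3 It :: "real \<times> real \<Rightarrow> real"
    and F2 F3 :: "real \<Rightarrow> real"
  assumes "a \<noteq> 0" and "b \<noteq> 0" and "c \<noteq> 0"
    and "open \<Omega>"
    and "smooth_on (snd ` \<Omega>) F1"
    and "smooth_on (snd ` snd ` \<Omega>) F2"
    and "smooth_on (snd ` snd ` \<Omega>) F3"
    and "antideriv_y (snd ` \<Omega>) (py F1) I1"
    and "antideriv_y (snd ` \<Omega>) (py (py (py F1))) I3"
    and "antideriv_y (snd ` \<Omega>) (pt F1) It"
  shows "(\<forall>u v. smooth_on \<Omega> u \<and> smooth_on \<Omega> v \<longrightarrow>
           (\<forall>p\<in>\<Omega>.
              D_t (T_t F1) u v p
              + D_x (T_x a b c F1 F2 F3 I1 I3 It) u v p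
              + D_y (T_y a b c F1 F2 F3 I1 I3 It) u v p
              = Lambda1 F1 u v p * H1 a b c u v p
                + Lambda2 b c F1 F2 F3 I1 I3 It u v p * H2 u v p))
         \<and> conserved_vector \<Omega> (H1 a b c) H2
             (T_t F1) (T_x a b c F1 F2 F3 I1 I3 It) (T_y a b c F1 F2 F3 I1 I3 It)"
proof -
  have "\<forall>u v. smooth_on \<Omega> u \<and> smooth_on \<Omega> v \<longrightarrow>
      (\<forall>p\<in>\<Omega>. total_div (T_t F1) (T_x a b c F1 F2 F3 I1 I3 It) (T_y a b c F1 F2 F3 I1 I3 It) u v p
        = Lambda1 F1 u v p * H1 a b c u v p + Lambda2 b c F1 F2 F3 I1 I3 It u v p * H2 u v p)"
    using total_div_BLMP assms(4,5,8-10) by blast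
  then show ?thesis
    by (auto simp: conserved_vector_def solution_on_def total_div_def)
qed

end
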